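(* Let $m(N,d)$ denote the number of maximum classes $C\subseteq\{\pm1\}^N$ of VC dimension $d$. For every $d>1$ there is $N_0=N_0(d)$ such that for all $N>N_0$, $$N^{(1+o(1))\frac{1}{d+1}\binom{N}{d}}\leq m(N,d)\leq N^{(1+o(1))\sum_{i=1}^d\binom{N}{i}}.$$
   Context: The VC dimension of a class $C\subseteq\{\pm1\}^N$ is the maximum size of a set of coordinates $Y\subseteq[N]$ such that every pattern in $\{\pm1\}^Y$ is the restriction of some member of $C$ to $Y$. A class of VC dimension $d$ is maximum if $|C|=\sum_{i=0}^d\binom{N}{i}$. The $o(1)$ terms tend to $0$ as $N\to\infty$ with $d$ fixed. *)

theory Defs
  imports Complex_Main "HOL-Library.FuncSet"
begin

definition sign_vectors :: "nat set \<Rightarrow> (nat \<Rightarrow> int) set" where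
  "sign_vectors Y = Y \<rightarrow>\<^sub>E {-1, 1}"

definition shatters :: "(nat \<Rightarrow> int) set \<Rightarrow> nat set \<Rightarrow> bool" where
  "shatters C Y \<longleftrightarrow> (\<forall>p \<in> sign_vectors Y. \<exists>c \<in> C. restrict c Y = p)"

text \<open>The maximum ranges over a finite set, which is nonempty unless \<open>C = {}\<close> (only the
  empty class fails to shatter the empty set). The value at \<open>C = {}\<close> is irrelevant below, as
  a maximum class is nonempty by its cardinality.\<close>

definition vc_dim :: "nat \<Rightarrow> (nat \<Rightarrow> int) set \<Rightarrow> nat" where
  "vc_dim N C = Max {card Y | Y. Y \<subseteq> {1..N} \<and> shatters C Y}"

definition maximum_class :: "nat \<Rightarrow> nat \<Rightarrow> (nat \<Rightarrow> int) set \<Rightarrow> bool" where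
  "maximum_class N d C \<longleftrightarrow>
     C \<subseteq> sign_vectors {1..N} \<and> vc_dim N C = d \<and> card C = (\<Sum>i=0..d. N choose i)"

definition num_maximum_classes :: "nat \<Rightarrow> nat \<Rightarrow> nat" where
  "num_maximum_classes N d = card {C. maximum_class N d C}"

end

theory Submission
  imports Defs "HOL-Number_Theory.Cong" "HOL-Real_Asymp.Real_Asymp"
begin

text \<open>Sign vectors are identified with sets of coordinates, classes with set families.

  Upper bound. A maximum family contains a cube in every set of at most \<open>d\<close> directions, so
  it has exactly as many strongly shattered sets as members. A family never has more strongly
  shattered sets than members; if a maximum family split into two nonempty parts without an edge of
  the cube between them, the empty set would be counted in both parts, a contradiction. Hence
  maximum families are connected, and connected families of \<open>n + 1\<close> sets are encoded by a
  starting vertex and a depth-first walk, which gives at most \<open>2^N (4N)^n\<close> of them.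

  Lower bound. Start from all sets of size at most \<open>d\<close>. Let \<open>R\<close> be the
  \<open>d\<close>-sets whose sum lies in a fixed residue class modulo \<open>d + 1\<close>, and replace every
  \<open>r\<close> in \<open>R\<close> by \<open>insert x r\<close>, where the residue of \<open>x\<close> is not one of the
  at most \<open>d\<close> residues occurring in \<open>r\<close>. No other member of \<open>R\<close> is contained in
  \<open>insert x r\<close>, so this set now misses exactly the trace \<open>r\<close> and the family remains
  maximum for all the independent choices, of which there are about \<open>N / (d + 1)\<close> for each
  \<open>r\<close>.\<close>

section \<open>Shattering and connectivity\<close>

definition trace_shatters :: "'a set set \<Rightarrow> 'a set \<Rightarrow> bool" where
  "trace_shatters F Y \<longleftrightarrow> (\<forall>Z\<subseteq>Y. \<exists>S\<in>F. S \<inter> Y = Z)"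

text \<open>\<open>F\<close> contains an entire subcube with direction set \<open>Y\<close> and base
  point \<open>S\<close>.\<close>

definition strongly_shatters :: "'a set set \<Rightarrow> 'a set \<Rightarrow> bool" where
  "strongly_shatters F Y \<longleftrightarrow> (\<exists>S. S \<inter> Y = {} \<and> (\<forall>Z\<subseteq>Y. S \<union> Z \<in> F))"

text \<open>The bound \<open>k\<close> is one more than the permitted VC dimension, so that
  \<open>k = 0\<close> describes the empty family and reductions of \<open>k\<close> can end
  there.\<close>

definition maximum_family :: "'a set \<Rightarrow> nat \<Rightarrow> 'a set set \<Rightarrow> bool" where
  "maximum_family X k F \<longleftrightarrow> F \<subseteq> Pow X \<and> (\<forall>Y\<subseteq>X. trace_shatters F Y \<longrightarrow> card Y < k) \<and>
     card F = (\<Sum>i<k. card X choose i)"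

section \<open>Splitting along one coordinate and the Sauer-Shelah bound\<close>

definition link :: "'a \<Rightarrow> 'a set \<Rightarrow> 'a set set \<Rightarrow> 'a set set" where
  "link x X F = {S \<in> Pow X. insert x S \<in> F}"

lemma link_subset: "link x X F \<subseteq> Pow X"
  by (auto simp: link_def)

lemma card_split:
  assumes "finite X" "x \<notin> X" "F \<subseteq> Pow (insert x X)"
  shows "card F = card (F \<inter> Pow X) + card (link x X F)"
proof -
  have F: "F = (F \<inter> Pow X) \<union> insert x ` link x X F"
  proof
    show "F \<subseteq> (F \<inter> Pow X) \<union> insert x ` link x X F"
    proof
      fix S assume S: "S \<in> F"
      then have SX: "S \<subseteq> insert x X" using assms(3) by blast
      show "S \<in> (F \<inter> Pow X) \<union> insert x ` link x X F"
      proof (cases "x \<in> S")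
        case True
        then have "S = insert x (S - {x})" by blast
        moreover have "S - {x} \<in> link x X F"
          using S SX True by (auto simp: link_def insert_absorb)
        ultimately show ?thesis by blast
      qed (use S SX in blast)
    qed
  qed (auto simp: link_def)
  have "finite (link x X F)"
    using assms(1) link_subset by (metis finite_Pow_iff finite_subset)
  moreover have "inj_on (insert x) (link x X F)"
    using assms(2) by (auto simp: inj_on_def link_def)
  ultimately show ?thesis
    using assms(1,2) by (subst F, subst card_Un_disjoint) (auto simp: card_image)
qed

text \<open>The union is the projection of \<open>F\<close> to \<open>X\<close>; forgetting
  \<open>x\<close> does not change traces on sets that avoid \<open>x\<close>.\<close>

lemma trace_shatters_union_split:
  assumes "x \<notin> X" "Y \<subseteq> X" "trace_shatters ((F \<inter> Pow X) \<union> link x X F) Y"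
  shows "trace_shatters F Y"
  unfolding trace_shatters_def
proof (intro allI impI)
  fix Z assume "Z \<subseteq> Y"
  then obtain S where S: "S \<in> (F \<inter> Pow X) \<union> link x X F" "S \<inter> Y = Z"
    using assms(3) unfolding trace_shatters_def by blast
  have "insert x S \<inter> Y = Z"
    using S assms by auto
  then show "\<exists>S\<in>F. S \<inter> Y = Z"
    using S by (auto simp: link_def)
qed

text \<open>The intersection consists of the lower ends of the edges of \<open>F\<close> in
  direction \<open>x\<close>, so each trace on \<open>Y\<close> occurs both with and without
  \<open>x\<close>.\<close>

lemma trace_shatters_insert:
  assumes "x \<notin> X" "Y \<subseteq> X" "trace_shatters ((F \<inter> Pow X) \<inter> link x X F) Y"
  shows "trace_shatters F (insert x Y)"
  unfolding trace_shatters_def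
proof (intro allI impI)
  fix Z assume Z: "Z \<subseteq> insert x Y"
  then have "Z - {x} \<subseteq> Y" by auto
  then obtain S where S: "S \<in> F" "S \<subseteq> X" "insert x S \<in> F" "S \<inter> Y = Z - {x}"
    using assms(3) unfolding trace_shatters_def link_def by blast
  show "\<exists>S\<in>F. S \<inter> insert x Y = Z"
  proof (cases "x \<in> Z")
    case True
    then show ?thesis using S by (intro bexI[of _ "insert x S"]) auto
  next
    case False
    then show ?thesis using S assms(1) by (intro bexI[of _ S]) auto
  qed
qed

lemma sum_choose_Suc:
  "(\<Sum>i<Suc k. Suc n choose i) = (\<Sum>i<Suc k. n choose i) + (\<Sum>i<k. n choose i)"
  by (induction k) auto

text \<open>Removing \<open>x\<close> splits \<open>card F\<close> into the sizes of the projection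
  \<open>?U\<close> and of the edge family \<open>?I\<close>. The former inherits the bound
  \<open>k\<close>; the latter satisfies it with \<open>k - 1\<close>, as each set it shatters
  extends by \<open>x\<close>. Pascal's rule adds the two bounds.\<close>

lemma sauer_shelah:
  assumes "finite X" "F \<subseteq> Pow X" "\<forall>Y\<subseteq>X. trace_shatters F Y \<longrightarrow> card Y < k"
  shows "card F \<le> (\<Sum>i<k. card X choose i)"
  using assms
proof (induction X arbitrary: F k rule: finite_induct)
  case empty
  show ?case
  proof (cases "F = {}")
    case False
    then have "F = {{}}" using empty by auto
    moreover from this have "k > 0"
      using empty by (auto simp: trace_shatters_def)
    ultimately show ?thesis by (cases k) (auto simp: sum.lessThan_Suc_shift simp del: sum.lessThan_Suc)
  qed auto
next
  case (insert x X)
  show ?case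
  proof (cases k)
    case 0
    then have "\<not> trace_shatters F {}" using insert.prems by blast
    then have "F = {}" by (auto simp: trace_shatters_def)
    then show ?thesis by simp
  next
    case (Suc l)
    let ?U = "(F \<inter> Pow X) \<union> link x X F" and ?I = "(F \<inter> Pow X) \<inter> link x X F"
    have fin: "finite (F \<inter> Pow X)" "finite (link x X F)"
      using insert.hyps link_subset[of x X F] by (auto intro: finite_subset)
    have "card ?U \<le> (\<Sum>i<k. card X choose i)"
    proof (rule insert.IH)
      show "\<forall>Y\<subseteq>X. trace_shatters ?U Y \<longrightarrow> card Y < k"
        using insert.prems(2) trace_shatters_union_split[OF insert.hyps(2)]
        by (meson subset_insertI2)
    qed (auto simp: link_def)
    moreover have "card ?I \<le> (\<Sum>i<l. card X choose i)"
    proof (rule insert.IH)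
      show "\<forall>Y\<subseteq>X. trace_shatters ?I Y \<longrightarrow> card Y < l"
      proof (intro allI impI)
        fix Y assume Y: "Y \<subseteq> X" "trace_shatters ?I Y"
        then have "card (insert x Y) < k"
          using insert.prems(2) trace_shatters_insert[OF insert.hyps(2) Y] by (meson insert_mono)
        moreover have "finite Y" "x \<notin> Y" using Y insert.hyps finite_subset by auto
        ultimately show "card Y < l" using Suc by simp
      qed
    qed (auto simp: link_def)
    ultimately show ?thesis
      using card_split[OF insert.hyps insert.prems(1)] card_Un_Int[OF fin] insert.hyps
      by (simp add: Suc sum_choose_Suc del: sum.lessThan_Suc)
  qed
qed

section \<open>Cubes inside set families\<close>

text \<open>For \<open>x\<close> in \<open>Y\<close>, equality in the Sauer-Shelah recursion forces
  equality for the edge family \<open>?I\<close>, which is therefore maximum with \<open>k\<close>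
  lowered by one. A cube of \<open>?I\<close> with directions \<open>Y - {x}\<close> is doubled by
  the edges in direction \<open>x\<close>.\<close>

lemma strongly_shatters_maximum:
  assumes "finite X" "maximum_family X k F" "Y \<subseteq> X" "card Y < k"
  shows "strongly_shatters F Y"
  using assms
proof (induction k arbitrary: X F Y)
  case (Suc k)
  note max = Suc.prems(2)[unfolded maximum_family_def]
  show ?case
  proof (cases "Y = {}")
    case True
    have "card F > 0" using max by (auto simp: sum.lessThan_Suc_shift simp del: sum.lessThan_Suc)
    then have "F \<noteq> {}" by auto
    then show ?thesis using True by (auto simp: strongly_shatters_def)
  next
    case False
    then obtain x where x: "x \<in> Y" by auto
    define X' where "X' = X - {x}"
    have X': "finite X'" "x \<notin> X'" "X = insert x X'"
      using Suc.prems x by (auto simp: X'_def)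
    let ?U = "(F \<inter> Pow X') \<union> link x X' F" and ?I = "(F \<inter> Pow X') \<inter> link x X' F"
    have fin: "finite (F \<inter> Pow X')" "finite (link x X' F)"
      using X' link_subset[of x X' F] by (auto intro: finite_subset)
    have sh: "\<forall>Y\<subseteq>X. trace_shatters F Y \<longrightarrow> card Y < Suc k" using max by blast
    have U: "card ?U \<le> (\<Sum>i<Suc k. card X' choose i)"
    proof (rule sauer_shelah[OF X'(1)])
      show "\<forall>Y\<subseteq>X'. trace_shatters ?U Y \<longrightarrow> card Y < Suc k"
        using sh X'(3) trace_shatters_union_split[OF X'(2)] by (meson subset_insertI2)
    qed (auto simp: link_def)
    have vc: "\<forall>Y\<subseteq>X'. trace_shatters ?I Y \<longrightarrow> card Y < k"
    proof (intro allI impI)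
      fix Y assume Y: "Y \<subseteq> X'" "trace_shatters ?I Y"
      then have "card (insert x Y) < Suc k"
        using sh trace_shatters_insert[OF X'(2) Y] unfolding X'(3) by (meson insert_mono)
      moreover have "finite Y" "x \<notin> Y" using Y X' finite_subset by auto
      ultimately show "card Y < k" by simp
    qed
    have I: "card ?I \<le> (\<Sum>i<k. card X' choose i)"
      using vc by (intro sauer_shelah[OF X'(1)]) (auto simp: link_def)
    have "card F = card ?U + card ?I"
      using card_split[OF X'(1,2), of F] card_Un_Int[OF fin] max X' by simp
    moreover have "card F = (\<Sum>i<Suc k. card X' choose i) + (\<Sum>i<k. card X' choose i)"
      using max X' by (simp add: sum_choose_Suc del: sum.lessThan_Suc)
    ultimately have "card ?I = (\<Sum>i<k. card X' choose i)"
      using U I by linarith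
    then have "maximum_family X' k ?I"
      using vc unfolding maximum_family_def by (auto simp: link_def)
    moreover have "card (Y - {x}) < k"
      using Suc.prems x finite_subset[OF Suc.prems(3,1)] card_gt_0_iff[of Y]
      by (auto simp: card_Diff_singleton)
    ultimately have "strongly_shatters ?I (Y - {x})"
      using X' Suc.prems by (intro Suc.IH) auto
    then obtain S where S: "S \<inter> (Y - {x}) = {}" "\<forall>Z\<subseteq>Y - {x}. S \<union> Z \<in> ?I"
      unfolding strongly_shatters_def by blast
    have "S \<union> {} \<in> ?I" using S(2) by blast
    then have "x \<notin> S" using X' by auto
    have "S \<union> Z \<in> F" if "Z \<subseteq> Y" for Z
    proof (cases "x \<in> Z")
      case True
      have "Z - {x} \<subseteq> Y - {x}" using that by blast
      then have "S \<union> (Z - {x}) \<in> ?I" using S(2) by simp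
      then have "insert x (S \<union> (Z - {x})) \<in> F" by (simp add: link_def)
      moreover have "insert x (S \<union> (Z - {x})) = S \<union> Z" using True by auto
      ultimately show ?thesis by simp
    next
      case False
      then have "Z \<subseteq> Y - {x}" using that by blast
      then show ?thesis using S(2) by simp
    qed
    then show ?thesis
      using S(1) \<open>x \<notin> S\<close> unfolding strongly_shatters_def by (intro exI[of _ S]) auto
  qed
qed simp

text \<open>Induction on the ground set: a cube without direction \<open>x\<close> lies in one of
  the halves \<open>?D\<close> and \<open>?L\<close>, while one with direction \<open>x\<close>
  leaves a cube on \<open>Y - {x}\<close> in both. So the count is at most that of a union plus that
  of an intersection, which is the sum of the counts of the halves.\<close>

lemma card_strongly_shattered_le:
  assumes "finite X" "F \<subseteq> Pow X"
  shows "card {Y \<in> Pow X. strongly_shatters F Y} \<le> card F"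
  using assms
proof (induction X arbitrary: F rule: finite_induct)
  case empty
  show ?case
  proof (cases "F = {}")
    case True
    then show ?thesis by (auto simp: strongly_shatters_def)
  next
    case False
    then have "F = {{}}" using empty by auto
    moreover have "card {Y \<in> Pow {}. strongly_shatters F Y} \<le> card {{} :: 'a set}"
      by (rule card_mono) auto
    ultimately show ?thesis by simp
  qed
next
  case (insert x X)
  let ?D = "F \<inter> Pow X" and ?L = "link x X F"
  let ?s = "\<lambda>G. {Y \<in> Pow X. strongly_shatters G Y}"
  have fin: "finite (?s G)" for G using insert.hyps by simp
  have "{Y \<in> Pow (insert x X). strongly_shatters F Y} \<subseteq>
      (?s ?D \<union> ?s ?L) \<union> insert x ` (?s ?D \<inter> ?s ?L)"
  proof
    fix Y assume "Y \<in> {Y \<in> Pow (insert x X). strongly_shatters F Y}"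
    then obtain S where Y: "Y \<subseteq> insert x X" and S: "S \<inter> Y = {}" "\<forall>Z\<subseteq>Y. S \<union> Z \<in> F"
      unfolding strongly_shatters_def by blast
    have SF: "S \<subseteq> insert x X" using S(2) insert.prems by blast
    show "Y \<in> (?s ?D \<union> ?s ?L) \<union> insert x ` (?s ?D \<inter> ?s ?L)"
    proof (cases "x \<in> Y")
      case True
      define W where "W = Y - {x}"
      have W: "Y = insert x W" "W \<subseteq> X" "x \<notin> W" using True Y by (auto simp: W_def)
      have "S \<union> Z \<in> ?D" if "Z \<subseteq> W" for Z
        using S SF W that insert.prems by blast
      moreover have "S \<union> Z \<in> ?L" if "Z \<subseteq> W" for Z
      proof -
        have "S \<union> insert x Z \<in> F" using S W that by blast
        moreover have "S \<union> Z \<subseteq> X" using S SF W that by blast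
        ultimately show ?thesis by (simp add: link_def)
      qed
      moreover have "S \<inter> W = {}" using S(1) W(1) by blast
      ultimately have "strongly_shatters ?D W" "strongly_shatters ?L W"
        unfolding strongly_shatters_def by (intro exI[of _ S]; simp)+
      then have "W \<in> ?s ?D \<inter> ?s ?L" using W(2) by simp
      then show ?thesis using W by blast
    next
      case False
      then have YX: "Y \<subseteq> X" using Y by auto
      show ?thesis
      proof (cases "x \<in> S")
        case True
        have "(S - {x}) \<union> Z \<in> ?L" if "Z \<subseteq> Y" for Z
        proof -
          have "insert x ((S - {x}) \<union> Z) = S \<union> Z" using True by auto
          moreover have "S \<union> Z \<in> F" "(S - {x}) \<union> Z \<subseteq> X" using S(2) that SF YX by blast+
          ultimately show ?thesis by (simp add: link_def)
        qed
        then have "strongly_shatters ?L Y"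
          using S(1) unfolding strongly_shatters_def by (intro exI[of _ "S - {x}"]) auto
        then show ?thesis using YX by blast
      next
        case False
        then have "S \<union> Z \<in> ?D" if "Z \<subseteq> Y" for Z
          using S that SF YX by blast
        then have "strongly_shatters ?D Y"
          using S(1) unfolding strongly_shatters_def by (intro exI[of _ S]) simp
        then show ?thesis using YX by blast
      qed
    qed
  qed
  then have "card {Y \<in> Pow (insert x X). strongly_shatters F Y} \<le>
      card ((?s ?D \<union> ?s ?L) \<union> insert x ` (?s ?D \<inter> ?s ?L))"
    using insert.hyps by (intro card_mono) auto
  also have "\<dots> \<le> card (?s ?D \<union> ?s ?L) + card (?s ?D \<inter> ?s ?L)"
    by (rule order_trans[OF card_Un_le add_left_mono]) (rule card_image_le, use fin in blast)
  also have "\<dots> = card (?s ?D) + card (?s ?L)"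
    by (rule card_Un_Int[OF fin fin, symmetric])
  also have "\<dots> \<le> card ?D + card ?L"
    by (intro add_mono insert.IH link_subset) blast
  also have "\<dots> = card F"
    using card_split[OF insert.hyps insert.prems] by simp
  finally show ?case .
qed

section \<open>Connectivity of maximum families\<close>

definition flip :: "'a \<Rightarrow> 'a set \<Rightarrow> 'a set" where
  "flip i S = (if i \<in> S then S - {i} else insert i S)"

lemma card_subsets_less:
  assumes "finite X"
  shows "card {Y \<in> Pow X. card Y < k} = (\<Sum>i<k. card X choose i)"
proof -
  have "{Y \<in> Pow X. card Y < k} = (\<Union>i\<in>{..<k}. {Y. Y \<subseteq> X \<and> card Y = i})" by auto
  then show ?thesis
    using assms by (auto simp: n_subsets intro!: card_UN_disjoint[THEN trans])
qed

lemma maximum_family_connected: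
  assumes fin: "finite X" and max: "maximum_family X k F"
    and A: "A \<subseteq> F" "A \<noteq> {}" "A \<noteq> F"
  shows "\<exists>S\<in>A. \<exists>i\<in>X. flip i S \<in> F - A"
proof (rule ccontr)
  assume "\<not> ?thesis"
  then have noedge: "\<And>S i. S \<in> A \<Longrightarrow> i \<in> X \<Longrightarrow> flip i S \<notin> F - A" by blast
  have FX: "F \<subseteq> Pow X" using max by (simp add: maximum_family_def)
  then have finF: "finite F" using fin finite_subset by auto
  let ?s = "\<lambda>G. {Y \<in> Pow X. strongly_shatters G Y}"
  have fins: "finite (?s G)" for G using fin by simp
  \<comment> \<open>A cube of \<open>F\<close> cannot meet both parts: moving from its base one
    direction at a time never crosses between \<open>A\<close> and \<open>F - A\<close>.\<close>
  have side: "S \<union> Z \<in> A \<longleftrightarrow> S \<in> A"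
    if "\<forall>Z\<subseteq>Y. S \<union> Z \<in> F" "Z \<subseteq> Y" "Y \<subseteq> X" "S \<inter> Y = {}" for S Y Z
  proof -
    have "finite Z" by (rule finite_subset[OF subset_trans[OF that(2,3)] fin])
    then show ?thesis using that(2)
    proof (induction Z rule: finite_induct)
      case (insert z Z)
      have z: "z \<notin> S \<union> Z" "z \<in> X" using insert that by auto
      have fl: "flip z (S \<union> Z) = S \<union> insert z Z" "flip z (S \<union> insert z Z) = S \<union> Z"
        using z by (auto simp: flip_def)
      have "S \<union> insert z Z \<in> F" "S \<union> Z \<in> F" using insert.prems that(1) by blast+
      then have "S \<union> insert z Z \<in> A \<longleftrightarrow> S \<union> Z \<in> A"
        using noedge[OF _ z(2)] fl by (metis DiffI)
      then show ?case using insert by auto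
    qed simp
  qed
  have sub: "?s F \<subseteq> ?s A \<union> ?s (F - A)"
  proof
    fix Y assume "Y \<in> ?s F"
    then obtain S where S: "Y \<subseteq> X" "S \<inter> Y = {}" "\<forall>Z\<subseteq>Y. S \<union> Z \<in> F"
      unfolding strongly_shatters_def by blast
    have "strongly_shatters A Y \<or> strongly_shatters (F - A) Y"
    proof (cases "S \<in> A")
      case True
      then have "\<forall>Z\<subseteq>Y. S \<union> Z \<in> A" using side[OF S(3) _ S(1,2)] by simp
      then show ?thesis using S(2) unfolding strongly_shatters_def by (intro disjI1 exI[of _ S]) simp
    next
      case False
      then have "\<forall>Z\<subseteq>Y. S \<union> Z \<in> F - A" using side[OF S(3) _ S(1,2)] S(3) by simp
      then show ?thesis using S(2) unfolding strongly_shatters_def by (intro disjI2 exI[of _ S]) simp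
    qed
    then show "Y \<in> ?s A \<union> ?s (F - A)" using S(1) by blast
  qed
  \<comment> \<open>Each part is nonempty and thus contains a cube of dimension zero; this double
    count is the contradiction.\<close>
  have "{} \<in> ?s A \<inter> ?s (F - A)"
    using A by (auto simp: strongly_shatters_def)
  then have "card (?s A \<inter> ?s (F - A)) > 0"
    using fins[of A] by (subst card_gt_0_iff) blast
  moreover have "card (?s A) \<le> card A" "card (?s (F - A)) \<le> card (F - A)"
    using A FX by (intro card_strongly_shattered_le fin; blast)+
  moreover have "card A + card (F - A) = card F"
    using A finF by (metis card_Diff_subset card_mono finite_subset le_add_diff_inverse)
  moreover have "card (?s F) \<le> card (?s A \<union> ?s (F - A))"
    using sub fins by (intro card_mono) auto
  \<comment> \<open>All sets of size below \<open>k\<close> are strongly shattered, and a maximum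
    family has exactly as many members as there are such sets.\<close>
  moreover have "card F \<le> card (?s F)"
  proof -
    have "card F = card {Y \<in> Pow X. card Y < k}"
      using max card_subsets_less[OF fin] by (simp add: maximum_family_def)
    also have "\<dots> \<le> card (?s F)"
      using strongly_shatters_maximum[OF fin max] fins by (intro card_mono) auto
    finally show ?thesis .
  qed
  ultimately show False
    using card_Un_Int[OF fins[of A] fins[of "F - A"]] by linarith
qed

section \<open>Encoding connected families\<close>

text \<open>A word is read as a depth-first walk: \<open>Some i\<close> pushes the neighbour along coordinate
  \<open>i\<close> of the current vertex onto the stack, \<open>None\<close> backtracks. Only forward steps
  carry a label, so a connected family of \<open>n + 1\<close> sets costs only \<open>n\<close> labels.\<close>

fun visited :: "'a set list \<Rightarrow> 'a option list \<Rightarrow> 'a set set" where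
  "visited [] w = {}"
| "visited (S # st) [] = {S}"
| "visited (S # st) (Some i # w) = insert S (visited (flip i S # S # st) w)"
| "visited (S # st) (None # w) = insert S (visited st w)"

definition words :: "'a set \<Rightarrow> nat \<Rightarrow> nat \<Rightarrow> 'a option list set" where
  "words X l a = {w. length w = l \<and> set w \<subseteq> insert None (Some ` X) \<and>
     length (filter (\<lambda>z. z \<noteq> None) w) = a}"

lemma visited_top: "S \<in> visited (S # st) w"
  by (cases w rule: list.exhaust; (cases "hd w")?) auto

text \<open>At a moment when \<open>T\<close> is on top of the stack, the detour
  \<open>Some i, None\<close> visits its neighbour and restores the stack, so the remaining walk is
  unaffected.\<close>

lemma visited_extend:
  assumes "T \<in> visited st w" "w \<in> words X l a" "i \<in> X"
  shows "\<exists>w'\<in>words X (Suc (Suc l)) (Suc a). visited st w' = insert (flip i T) (visited st w)"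
  using assms
proof (induction st w arbitrary: l a rule: visited.induct)
  case (1 w)
  then show ?case by simp
next
  case (2 S st)
  then show ?case
    by (intro bexI[of _ "[Some i, None]"]) (auto simp: words_def visited_top split: list.splits)
next
  case (3 S st j w)
  show ?case
  proof (cases "T = S")
    case True
    then show ?thesis using 3
      by (intro bexI[of _ "Some i # None # Some j # w"]) (auto simp: words_def)
  next
    case False
    obtain l' a' where la: "l = Suc l'" "a = Suc a'" "w \<in> words X l' a'" "j \<in> X"
      using 3 by (auto simp: words_def)
    then obtain w' where "w' \<in> words X (Suc (Suc l')) (Suc a')"
      "visited (flip j S # S # st) w' = insert (flip i T) (visited (flip j S # S # st) w)"
      using "3.IH"[of l' a'] "3.prems" False by (metis insertE visited.simps(3))
    then show ?thesis using la
      by (intro bexI[of _ "Some j # w'"]) (auto simp: words_def)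
  qed
next
  case (4 S st w)
  show ?case
  proof (cases "T = S")
    case True
    then show ?thesis using 4
      by (intro bexI[of _ "Some i # None # None # w"]) (auto simp: words_def)
  next
    case False
    obtain l' where la: "l = Suc l'" "w \<in> words X l' a"
      using 4 by (auto simp: words_def)
    then obtain w' where "w' \<in> words X (Suc (Suc l')) (Suc a)"
      "visited st w' = insert (flip i T) (visited st w)"
      using "4.IH"[of l' a] "4.prems" False by (metis insertE visited.simps(4))
    then show ?thesis using la
      by (intro bexI[of _ "None # w'"]) (auto simp: words_def)
  qed
qed

lemma finite_words: "finite X \<Longrightarrow> finite (words X l a)"
  unfolding words_def
  by (rule finite_subset[OF _ finite_lists_length_eq[of "insert None (Some ` X)" l]]) auto

text \<open>The positions of the forward steps leave at most \<open>2 ^ l\<close> choices, and each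
  of the \<open>a\<close> forward steps has \<open>card X\<close> labels; the recursion on the first
  letter counts this.\<close>

lemma card_words_le:
  assumes "finite X"
  shows "card (words X l a) \<le> card X ^ a * 2 ^ l"
proof (induction l arbitrary: a)
  case 0
  have "words X 0 a \<subseteq> {[]}" by (auto simp: words_def)
  then have "card (words X 0 a) \<le> card {[] :: 'a option list}" by (intro card_mono) auto
  moreover have "words X 0 a = {}" if "a > 0" using that by (auto simp: words_def)
  ultimately show ?case by (cases a) auto
next
  case (Suc l)
  show ?case
  proof (cases a)
    case 0
    have "words X (Suc l) a \<subseteq> (#) None ` words X l a"
      using 0 by (auto simp: words_def length_Suc_conv)
    then have "card (words X (Suc l) a) \<le> card (words X l a)"
      by (meson assms card_image_le card_mono finite_imageI finite_words order_trans)
    then show ?thesis using Suc[of a] by simp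
  next
    case (Suc b)
    let ?f = "\<lambda>(i, w). Some i # w"
    have "words X (Suc l) a \<subseteq> (#) None ` words X l a \<union> ?f ` (X \<times> words X l b)"
    proof
      fix v assume v: "v \<in> words X (Suc l) a"
      then obtain z w where "v = z # w" by (auto simp: words_def length_Suc_conv)
      then show "v \<in> (#) None ` words X l a \<union> ?f ` (X \<times> words X l b)"
        using v Suc by (cases z) (auto simp: words_def image_iff)
    qed
    then have "card (words X (Suc l) a) \<le>
        card ((#) None ` words X l a \<union> ?f ` (X \<times> words X l b))"
      using assms by (intro card_mono) (auto simp: finite_words)
    also have "\<dots> \<le> card (words X l a) + card (X \<times> words X l b)"
      using assms
      by (intro order_trans[OF card_Un_le] add_mono card_image_le) (auto simp: finite_words)
    also have "\<dots> \<le> card X ^ a * 2 ^ l + card X * (card X ^ b * 2 ^ l)"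
      using Suc.IH[of a] Suc.IH[of b] by (intro add_mono) (auto simp: card_cartesian_product)
    also have "\<dots> = card X ^ a * 2 ^ Suc l" using Suc by simp
    finally show ?thesis .
  qed
qed

text \<open>The walk is grown by one vertex at a time: while its visited part is not all of
  \<open>F\<close>, connectivity provides an edge leaving it, along which a detour is
  inserted.\<close>

lemma maximum_family_visited:
  assumes fin: "finite X" and max: "maximum_family X k F" and n: "card F = Suc n"
  shows "\<exists>S\<in>Pow X. \<exists>w\<in>words X (2 * n) n. visited [S] w = F"
proof -
  have FX: "F \<subseteq> Pow X" using max by (simp add: maximum_family_def)
  then have finF: "finite F" using fin finite_subset by auto
  obtain S where S: "S \<in> F" using n by fastforce
  have "\<exists>w\<in>words X (2 * m) m. visited [S] w \<subseteq> F \<and> card (visited [S] w) = Suc m"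
    if "m \<le> n" for m
    using that
  proof (induction m)
    case 0
    show ?case using S by (intro bexI[of _ "[]"]) (auto simp: words_def)
  next
    case (Suc m)
    then obtain w where w: "w \<in> words X (2 * m) m" "visited [S] w \<subseteq> F"
      "card (visited [S] w) = Suc m" by auto
    have "visited [S] w \<noteq> F" using w n Suc.prems by auto
    then obtain T i where Ti: "T \<in> visited [S] w" "i \<in> X" "flip i T \<in> F - visited [S] w"
      using maximum_family_connected[OF fin max w(2)] visited_top[of S "[]" w] by blast
    obtain w' where w': "w' \<in> words X (Suc (Suc (2 * m))) (Suc m)"
      "visited [S] w' = insert (flip i T) (visited [S] w)"
      using visited_extend[OF Ti(1) w(1) Ti(2)] by blast
    have "card (visited [S] w') = Suc (Suc m)"
      using w' w Ti finF finite_subset[OF w(2)] by simp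
    then show ?case using w' w Ti by (intro bexI[of _ w']) auto
  qed
  from this[of n] obtain w where "w \<in> words X (2 * n) n" "visited [S] w \<subseteq> F"
    "card (visited [S] w) = Suc n" by auto
  then have "visited [S] w = F" using n finF by (metis card_subset_eq)
  then show ?thesis using S FX \<open>w \<in> _\<close> by blast
qed

lemma card_maximum_families_le:
  fixes X :: "'a set"
  assumes fin: "finite X" and k: "(\<Sum>i<k. card X choose i) = Suc n"
  shows "card {F. maximum_family X k F} \<le> 2 ^ card X * (4 * card X) ^ n"
proof -
  let ?P = "Pow X \<times> words X (2 * n) n"
  have "{F. maximum_family X k F} \<subseteq> (\<lambda>(S, w). visited [S] w) ` ?P"
  proof
    fix F :: "'a set set" assume "F \<in> {F. maximum_family X k F}"
    then have "maximum_family X k F" by simp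
    moreover from this have "card F = Suc n" using k by (simp add: maximum_family_def)
    ultimately show "F \<in> (\<lambda>(S, w). visited [S] w) ` ?P"
      using maximum_family_visited[OF fin] by force
  qed
  then have "card {F. maximum_family X k F} \<le> card ?P"
    using fin by (meson finite_Pow_iff finite_SigmaI finite_words surj_card_le)
  also have "\<dots> = 2 ^ card X * card (words X (2 * n) n)"
    using fin by (simp add: card_cartesian_product card_Pow)
  \<comment> \<open>A word has \<open>n\<close> forward and \<open>n\<close> backtracking letters;
    its length \<open>2 * n\<close> is the origin of the factor 4 per label.\<close>
  also have "\<dots> \<le> 2 ^ card X * (card X ^ n * 2 ^ (2 * n))"
    using card_words_le[OF fin] by (intro mult_left_mono) auto
  also have "\<dots> = 2 ^ card X * (4 * card X) ^ n"
    by (simp add: power_mult power_mult_distrib)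
  finally show ?thesis .
qed

section \<open>Sign vectors as sets\<close>

definition positives :: "nat \<Rightarrow> (nat \<Rightarrow> int) \<Rightarrow> nat set" where
  "positives N c = {i \<in> {1..N}. c i = 1}"

lemma bij_betw_positives: "bij_betw (positives N) (sign_vectors {1..N}) (Pow {1..N})"
proof (rule bij_betw_byWitness[where f' = "\<lambda>S. restrict (\<lambda>i. if i \<in> S then 1 else -1) {1..N}"])
  show "\<forall>c\<in>sign_vectors {1..N}.
      restrict (\<lambda>i. if i \<in> positives N c then 1 else -1) {1..N} = c"
  proof (intro ballI ext)
    fix c i assume c: "c \<in> sign_vectors {1..N}"
    show "restrict (\<lambda>i. if i \<in> positives N c then 1 else -1) {1..N} i = c i"
    proof (cases "i \<in> {1..N}")
      case True
      then have "c i \<in> {-1, 1}" using c unfolding sign_vectors_def by (rule PiE_mem[rotated])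
      then show ?thesis using True by (auto simp: positives_def)
    next
      case False
      then have "c i = undefined" by (rule PiE_arb[OF c[unfolded sign_vectors_def]])
      then show ?thesis using False by auto
    qed
  qed
  show "\<forall>S\<in>Pow {1..N}. positives N (restrict (\<lambda>i. if i \<in> S then 1 else -1) {1..N}) = S"
    by (auto simp: positives_def)
  show "positives N ` sign_vectors {1..N} \<subseteq> Pow {1..N}"
    by (auto simp: positives_def)
  show "(\<lambda>S. restrict (\<lambda>i. if i \<in> S then 1 else -1) {1..N}) ` Pow {1..N} \<subseteq> sign_vectors {1..N}"
    by (auto simp: sign_vectors_def split: if_splits)
qed

lemma shatters_iff_trace_shatters:
  assumes C: "C \<subseteq> sign_vectors {1..N}" and Y: "Y \<subseteq> {1..N}"
  shows "shatters C Y \<longleftrightarrow> trace_shatters (positives N ` C) Y"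
proof
  assume sh: "shatters C Y"
  show "trace_shatters (positives N ` C) Y"
    unfolding trace_shatters_def
  proof (intro allI impI)
    fix Z assume Z: "Z \<subseteq> Y"
    let ?p = "restrict (\<lambda>i. if i \<in> Z then 1 else -1 :: int) Y"
    have "?p \<in> sign_vectors Y" by (auto simp: sign_vectors_def)
    then obtain c where c: "c \<in> C" "restrict c Y = ?p"
      using sh unfolding shatters_def by blast
    have "c i = (if i \<in> Z then 1 else -1)" if "i \<in> Y" for i
      using fun_cong[OF c(2), of i] that by simp
    then have "positives N c \<inter> Y = Z"
      using Y Z by (auto simp: positives_def split: if_splits)
    then show "\<exists>S\<in>positives N ` C. S \<inter> Y = Z" using c by blast
  qed
next
  assume sh: "trace_shatters (positives N ` C) Y"
  show "shatters C Y"
    unfolding shatters_def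
  proof
    fix p assume p: "p \<in> sign_vectors Y"
    have "{i \<in> Y. p i = 1} \<subseteq> Y" by auto
    then obtain c where c: "c \<in> C" "positives N c \<inter> Y = {i \<in> Y. p i = 1}"
      using sh unfolding trace_shatters_def by blast
    have "restrict c Y = p"
    proof
      fix i
      show "restrict c Y i = p i"
      proof (cases "i \<in> Y")
        case True
        then have "c i \<in> {-1, 1}" "p i \<in> {-1, 1}"
          using c(1) C Y p unfolding sign_vectors_def by (blast dest: PiE_mem)+
        moreover have "c i = 1 \<longleftrightarrow> p i = 1"
          using c(2) True Y unfolding positives_def by blast
        ultimately show ?thesis using True by auto
      next
        case False
        then show ?thesis using p unfolding sign_vectors_def by (auto dest: PiE_arb)
      qed
    qed
    then show "\<exists>c\<in>C. restrict c Y = p" using c(1) by blast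
  qed
qed

text \<open>The family side only bounds the dimension from above. That \<open>d\<close> is attained
  follows from its size: otherwise Sauer-Shelah would give a bound smaller by
  \<open>N choose d\<close>, which is positive for \<open>d \<le> N\<close>.\<close>

lemma maximum_class_iff:
  assumes C: "C \<subseteq> sign_vectors {1..N}" and d: "d \<le> N"
  shows "maximum_class N d C \<longleftrightarrow> maximum_family {1..N} (Suc d) (positives N ` C)"
proof -
  let ?F = "positives N ` C"
  let ?V = "{card Y | Y. Y \<subseteq> {1..N} \<and> shatters C Y}"
  have "inj_on (positives N) C"
    using bij_betw_positives C by (meson bij_betw_imp_inj_on inj_on_subset)
  then have card: "card ?F = card C" by (rule card_image)
  have FX: "?F \<subseteq> Pow {1..N}" by (auto simp: positives_def)
  have V: "?V = card ` {Y \<in> Pow {1..N}. trace_shatters ?F Y}"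
    using shatters_iff_trace_shatters[OF C] by auto
  then have finV: "finite ?V" by simp
  have sums: "(\<Sum>i=0..d. N choose i) = (\<Sum>i<Suc d. N choose i)"
    by (simp add: atLeast0AtMost lessThan_Suc_atMost del: sum.lessThan_Suc)
  show ?thesis
  proof
    assume mc: "maximum_class N d C"
    have "card Y < Suc d" if "Y \<subseteq> {1..N}" "trace_shatters ?F Y" for Y
    proof -
      have "card Y \<in> ?V" using that V by auto
      then have "card Y \<le> Max ?V" by (rule Max_ge[OF finV])
      then show ?thesis using mc by (simp add: maximum_class_def vc_dim_def)
    qed
    then show "maximum_family {1..N} (Suc d) ?F"
      using mc FX card sums unfolding maximum_family_def maximum_class_def by simp
  next
    assume mf: "maximum_family {1..N} (Suc d) ?F"
    then have le: "\<forall>Y\<subseteq>{1..N}. trace_shatters ?F Y \<longrightarrow> card Y < Suc d"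
      and cF: "card ?F = (\<Sum>i<Suc d. N choose i)"
      unfolding maximum_family_def by auto
    have "\<exists>Y\<subseteq>{1..N}. trace_shatters ?F Y \<and> card Y = d"
    proof (rule ccontr)
      assume "\<not> ?thesis"
      then have "\<forall>Y\<subseteq>{1..N}. trace_shatters ?F Y \<longrightarrow> card Y < d"
        using le less_Suc_eq by metis
      then have "card ?F \<le> (\<Sum>i<d. N choose i)"
        using sauer_shelah[of "{1..N}" ?F d] FX by simp
      moreover have "(N choose d) > 0" using d by (rule zero_less_binomial)
      ultimately show False using cF by simp
    qed
    then have "d \<in> ?V" unfolding V by blast
    moreover have "v \<le> d" if "v \<in> ?V" for v
      using that le unfolding V by auto
    ultimately have "Max ?V = d" using finV by (intro Max_eqI) auto
    then show "maximum_class N d C"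
      using C card cF sums unfolding maximum_class_def vc_dim_def by simp
  qed
qed

lemma num_maximum_classes_eq:
  assumes "d \<le> N"
  shows "num_maximum_classes N d = card {F. maximum_family {1..N} (Suc d) F}"
proof -
  have bij: "bij_betw ((`) (positives N)) (Pow (sign_vectors {1..N})) (Pow (Pow {1..N}))"
    by (rule bij_betw_Pow[OF bij_betw_positives])
  have "((`) (positives N)) ` {C. maximum_class N d C} = {F. maximum_family {1..N} (Suc d) F}"
  proof
    show "((`) (positives N)) ` {C. maximum_class N d C} \<subseteq> {F. maximum_family {1..N} (Suc d) F}"
      using maximum_class_iff assms by (auto simp: maximum_class_def)
    show "{F. maximum_family {1..N} (Suc d) F} \<subseteq> ((`) (positives N)) ` {C. maximum_class N d C}"
    proof
      fix F assume F: "F \<in> {F. maximum_family {1..N} (Suc d) F}"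
      then have "F \<in> Pow (Pow {1..N})" by (simp add: maximum_family_def)
      then have "F \<in> ((`) (positives N)) ` Pow (sign_vectors {1..N})"
        using bij_betw_imp_surj_on[OF bij] by simp
      then obtain C where C: "C \<subseteq> sign_vectors {1..N}" "F = positives N ` C" by blast
      then show "F \<in> ((`) (positives N)) ` {C. maximum_class N d C}"
        using F maximum_class_iff[OF C(1) assms] by blast
    qed
  qed
  moreover have "inj_on ((`) (positives N)) {C. maximum_class N d C}"
    using bij_betw_imp_inj_on[OF bij] by (rule inj_on_subset) (auto simp: maximum_class_def)
  ultimately show ?thesis
    unfolding num_maximum_classes_def by (metis card_image)
qed

section \<open>Modifying the ball of radius \<open>d\<close>\<close>

definition replace_sets :: "'a set \<Rightarrow> nat \<Rightarrow> 'a set set \<Rightarrow> ('a set \<Rightarrow> 'a) \<Rightarrow> 'a set set" where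
  "replace_sets X d R f =
     ({S \<in> Pow X. card S < Suc d} - R) \<union> (\<lambda>r. insert (f r) r) ` R"

text \<open>The only members with more than \<open>d\<close> elements are the new sets, so a
  shattered \<open>Y\<close> of that size must be one of them, say \<open>insert (f r) r\<close>.
  The trace \<open>r\<close> on it is then missing. Isolation also makes the new sets distinct,
  which preserves the cardinality.\<close>

lemma maximum_family_replace_sets:
  assumes fin: "finite X"
    and R: "\<And>r. r \<in> R \<Longrightarrow> r \<subseteq> X \<and> card r = d"
    and f: "\<And>r. r \<in> R \<Longrightarrow> f r \<in> X - r"
    and isolated: "\<And>r r'. r \<in> R \<Longrightarrow> r' \<in> R \<Longrightarrow> r' \<subseteq> insert (f r) r \<Longrightarrow> r' = r"
  shows "maximum_family X (Suc d) (replace_sets X d R f)"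
proof -
  let ?B = "{S \<in> Pow X. card S < Suc d}" and ?g = "\<lambda>r. insert (f r) r"
  have finR: "finite r" if "r \<in> R" for r
    using R[OF that] fin finite_subset by blast
  have cg: "card (?g r) = Suc d" if "r \<in> R" for r
    using R[OF that] f[OF that] finR[OF that] by simp
  have finB: "finite ?B" using fin by simp
  have RB: "R \<subseteq> ?B" using R by auto
  have inj: "inj_on ?g R"
  proof (rule inj_onI)
    fix r r' assume "r \<in> R" "r' \<in> R" "?g r = ?g r'"
    then show "r = r'" using isolated[of r r'] by auto
  qed
  have "card (replace_sets X d R f) = card (?B - R) + card (?g ` R)"
    unfolding replace_sets_def using finB cg finite_subset[OF RB finB]
    by (intro card_Un_disjoint) auto
  also have "\<dots> = card ?B"
    using card_image[OF inj] card_Diff_subset[OF finite_subset[OF RB finB] RB] card_mono[OF finB RB]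
    by simp
  also have "\<dots> = (\<Sum>i<Suc d. card X choose i)"
    by (rule card_subsets_less[OF fin])
  finally have card: "card (replace_sets X d R f) = (\<Sum>i<Suc d. card X choose i)" .
  have le: "card S \<le> Suc d" if "S \<in> replace_sets X d R f" for S
    using that cg by (auto simp: replace_sets_def)
  have sub: "replace_sets X d R f \<subseteq> Pow X"
    using R f by (auto simp: replace_sets_def)
  have "card Y < Suc d" if Y: "Y \<subseteq> X" and sh: "trace_shatters (replace_sets X d R f) Y" for Y
  proof (rule ccontr)
    assume "\<not> card Y < Suc d"
    then have cY: "card Y \<ge> Suc d" by simp
    obtain S where S: "S \<in> replace_sets X d R f" "S \<inter> Y = Y"
      using sh unfolding trace_shatters_def by blast
    have "S \<subseteq> X" using S(1) sub by blast
    then have "finite S" using fin by (rule finite_subset)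
    moreover have "Y \<subseteq> S" using S(2) by blast
    ultimately have "Y = S" using le[OF S(1)] cY by (intro card_seteq) auto
    then have "Y \<in> ?g ` R" using S(1) cY by (auto simp: replace_sets_def)
    then obtain r where r: "r \<in> R" "Y = ?g r" by blast
    have "r \<subseteq> Y" using r(2) by blast
    then obtain T where T: "T \<in> replace_sets X d R f" "T \<inter> Y = r"
      using sh unfolding trace_shatters_def by blast
    have "T \<subseteq> X" using T(1) sub by blast
    then have finT: "finite T" using fin by (rule finite_subset)
    consider "T \<in> ?B - R" | r' where "r' \<in> R" "T = ?g r'"
      using T(1) unfolding replace_sets_def by blast
    then show False
    proof cases
      \<comment> \<open>A member of the ball containing \<open>r\<close> has no room for further
        elements and equals \<open>r\<close>, which was removed.\<close>
      case 1
      then have "r = T"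
        using T(2) R[OF r(1)] finT by (intro card_seteq) auto
      then show False using 1 r(1) by blast
    next
      \<comment> \<open>Isolation leaves only the new set of \<open>r\<close> itself, whose trace is
        all of \<open>Y\<close>.\<close>
      case 2
      then have "r \<subseteq> ?g r'" using T(2) by blast
      then have "r = r'" by (rule isolated[OF 2(1) r(1)])
      then have "T \<inter> Y = Y" using 2 r by blast
      then show False using T(2) r f[OF r(1)] by blast
    qed
  qed
  then show ?thesis using card sub unfolding maximum_family_def by blast
qed

text \<open>The members of size \<open>d + 1\<close> reveal the choices: by isolation each of them
  contains only one element of \<open>R\<close>, and its extra point is the chosen value.\<close>

lemma inj_on_replace_sets:
  assumes R: "\<And>r. r \<in> R \<Longrightarrow> finite r \<and> card r = d"
    and G: "\<And>r x. r \<in> R \<Longrightarrow> x \<in> G r \<Longrightarrow> x \<notin> r"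
    and isolated: "\<And>r r' x. r \<in> R \<Longrightarrow> r' \<in> R \<Longrightarrow> x \<in> G r \<Longrightarrow> r' \<subseteq> insert x r \<Longrightarrow> r' = r"
  shows "inj_on (replace_sets X d R) (PiE R G)"
proof (rule inj_onI)
  fix f g assume f: "f \<in> PiE R G" and g: "g \<in> PiE R G"
    and eq: "replace_sets X d R f = replace_sets X d R g"
  show "f = g"
  proof (rule PiE_ext[OF f g])
    fix r assume r: "r \<in> R"
    then have fr: "f r \<in> G r" using f by (rule PiE_mem[rotated])
    have "insert (f r) r \<in> replace_sets X d R g"
      unfolding eq[symmetric] using r by (auto simp: replace_sets_def)
    moreover have "card (insert (f r) r) = Suc d"
      using R[OF r] G[OF r fr] by simp
    ultimately obtain r' where r': "r' \<in> R" "insert (f r) r = insert (g r') r'"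
      by (auto simp: replace_sets_def)
    then have "r' = r" using isolated[OF r r'(1) fr] by blast
    then show "f r = g r" using r' G[OF r fr] by blast
  qed
qed

section \<open>Independent replacements from residues modulo \<open>d + 1\<close>\<close>

definition residue_sets :: "nat \<Rightarrow> nat \<Rightarrow> nat \<Rightarrow> nat set set" where
  "residue_sets N d c = {r \<in> Pow {1..N}. card r = d \<and> \<Sum>r mod Suc d = c}"

definition free_points :: "nat \<Rightarrow> nat \<Rightarrow> nat set \<Rightarrow> nat set" where
  "free_points N d r = {x \<in> {1..N}. x mod Suc d \<notin> (\<lambda>y. y mod Suc d) ` r}"

text \<open>Exchanging an element of \<open>r\<close> for a point \<open>x\<close> in a different residue class changes
  the sum modulo \<open>d + 1\<close>.\<close>

lemma residue_sets_private:
  assumes r: "r \<in> residue_sets N d c" and r': "r' \<in> residue_sets N d c"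
    and x: "x \<in> free_points N d r" and sub: "r' \<subseteq> insert x r"
  shows "r' = r"
proof (cases "x \<in> r'")
  case False
  have "finite r" using r finite_subset by (auto simp: residue_sets_def)
  moreover have "r' \<subseteq> r" using False sub by blast
  ultimately show ?thesis using r r' by (intro card_subset_eq) (auto simp: residue_sets_def)
next
  case True
  have fin: "finite r" "finite r'" using r r' finite_subset by (auto simp: residue_sets_def)
  define w where "w = r' - {x}"
  have w: "r' = insert x w" "x \<notin> w" "finite w" "w \<subseteq> r"
    using True sub fin by (auto simp: w_def)
  have "card r = Suc (card w)" using r r' w by (simp add: residue_sets_def)
  then have "card (r - w) = 1" using w fin by (simp add: card_Diff_subset)
  then obtain y where y: "r - w = {y}" by (rule card_1_singletonE)
  then have ry: "r = insert y w" "y \<notin> w" using w by auto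
  have "[x + \<Sum>w = y + \<Sum>w] (mod Suc d)"
    using r r' w ry by (simp add: residue_sets_def Cong.cong_def)
  then have "[x = y] (mod Suc d)" by (simp only: cong_add_rcancel_nat)
  then have "x mod Suc d = y mod Suc d" by (simp only: Cong.cong_def)
  then have False using x ry unfolding free_points_def by blast
  then show ?thesis ..
qed

text \<open>The \<open>d\<close> elements of \<open>r\<close> miss at least one of the
  \<open>d + 1\<close> residues, and every block of \<open>d + 1\<close> consecutive coordinates
  contains a point of the missed class.\<close>

lemma card_free_points_ge:
  assumes "finite r" "card r = d"
  shows "N div Suc d \<le> card (free_points N d r)"
proof -
  have "card ((\<lambda>y. y mod Suc d) ` r) < card {..d}"
    using card_image_le[OF assms(1), of "\<lambda>y. y mod Suc d"] assms(2) by simp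
  then have "\<not> {..d} \<subseteq> (\<lambda>y. y mod Suc d) ` r"
    using assms(1) by (meson card_mono finite_imageI leD)
  then obtain t where t: "t \<le> d" "t \<notin> (\<lambda>y. y mod Suc d) ` r" by blast
  \<comment> \<open>Coordinates start at 1, so the residue 0 is represented by
    \<open>Suc d\<close>.\<close>
  define u where "u = (if t = 0 then Suc d else t)"
  have u: "1 \<le> u" "u \<le> Suc d" "u mod Suc d = t" using t(1) by (auto simp: u_def)
  let ?h = "\<lambda>j. j * Suc d + u"
  have "?h ` {..<N div Suc d} \<subseteq> free_points N d r"
  proof
    fix x assume "x \<in> ?h ` {..<N div Suc d}"
    then obtain j where j: "j < N div Suc d" "x = ?h j" by blast
    have "x \<le> Suc j * Suc d" using j u by simp
    also have "\<dots> \<le> (N div Suc d) * Suc d" using j(1) by (intro mult_le_mono1) simp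
    also have "\<dots> \<le> N" by (rule div_times_less_eq_dividend)
    finally have "x \<le> N" .
    moreover have "x mod Suc d = t" using j(2) u(3) by (metis mod_mult_self3)
    ultimately show "x \<in> free_points N d r" using u j t by (simp add: free_points_def)
  qed
  then have "card (?h ` {..<N div Suc d}) \<le> card (free_points N d r)"
    by (intro card_mono) (auto simp: free_points_def)
  moreover have "inj_on ?h {..<N div Suc d}" by (auto simp: inj_on_def simp del: mult_Suc_right)
  ultimately show ?thesis by (simp add: card_image)
qed

text \<open>Pigeonhole: the \<open>d + 1\<close> residue classes of the sum partition the
  \<open>d\<close>-sets.\<close>

lemma ex_large_residue_sets: "\<exists>c. (N choose d) \<le> Suc d * card (residue_sets N d c)"
proof (rule ccontr)
  assume "\<not> ?thesis"
  then have small: "Suc d * card (residue_sets N d c) < (N choose d)" for c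
    by (simp add: not_le)
  have "{r. r \<subseteq> {1..N} \<and> card r = d} = (\<Union>c\<in>{..d}. residue_sets N d c)"
    by (auto simp: residue_sets_def less_Suc_eq_le[symmetric])
  then have "(N choose d) = card (\<Union>c\<in>{..d}. residue_sets N d c)"
    using n_subsets[of "{1..N}" d] by simp
  also have "\<dots> \<le> (\<Sum>c\<le>d. card (residue_sets N d c))"
    by (rule card_UN_le) simp
  finally have "Suc d * (N choose d) \<le> (\<Sum>c\<le>d. Suc d * card (residue_sets N d c))"
    unfolding sum_distrib_left[symmetric] by (rule mult_left_mono) simp
  also have "\<dots> < (\<Sum>c\<le>d. (N choose d))"
    using small by (intro sum_strict_mono) auto
  finally show False by simp
qed

text \<open>Here \<open>R\<close> is the size of a largest-enough residue class; each of its sets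
  independently receives one of at least \<open>N div Suc d\<close> free points.\<close>

lemma card_maximum_families_ge:
  "\<exists>R. (N choose d) \<le> Suc d * R \<and>
     (N div Suc d) ^ R \<le> card {F. maximum_family {1..N} (Suc d) F}"
proof -
  obtain c where c: "(N choose d) \<le> Suc d * card (residue_sets N d c)"
    using ex_large_residue_sets by blast
  let ?R = "residue_sets N d c" and ?G = "free_points N d"
  have R: "r \<subseteq> {1..N} \<and> card r = d" "finite r \<and> card r = d" if "r \<in> ?R" for r
    using that finite_subset by (auto simp: residue_sets_def)
  have G: "x \<in> {1..N} - r" if "x \<in> ?G r" for r x
    using that by (auto simp: free_points_def)
  have finR: "finite ?R" by (simp add: residue_sets_def)
  have "(N div Suc d) ^ card ?R \<le> (\<Prod>r\<in>?R. card (?G r))"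
    unfolding prod_constant[symmetric] using card_free_points_ge R(2) by (intro prod_mono) auto
  also have "\<dots> = card (PiE ?R ?G)" using finR by (simp add: card_PiE)
  also have "\<dots> = card (replace_sets {1..N} d ?R ` PiE ?R ?G)"
    using R(2) G residue_sets_private
    by (intro card_image[symmetric] inj_on_replace_sets) blast+
  also have "\<dots> \<le> card {F. maximum_family {1..N} (Suc d) F}"
  proof (rule card_mono)
    show "finite {F. maximum_family {1..N} (Suc d) F}"
      by (rule finite_subset[of _ "Pow (Pow {1..N})"]) (auto simp: maximum_family_def)
    show "replace_sets {1..N} d ?R ` PiE ?R ?G \<subseteq> {F. maximum_family {1..N} (Suc d) F}"
    proof
      fix F assume "F \<in> replace_sets {1..N} d ?R ` PiE ?R ?G"
      then obtain f where f: "f \<in> PiE ?R ?G" "F = replace_sets {1..N} d ?R f" by blast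
      have "maximum_family {1..N} (Suc d) F"
        unfolding f(2)
        using R(1) G[OF PiE_mem[OF f(1)]] residue_sets_private[OF _ _ PiE_mem[OF f(1)]]
        by (intro maximum_family_replace_sets) auto
      then show "F \<in> {F. maximum_family {1..N} (Suc d) F}" by simp
    qed
  qed
  finally show ?thesis using c by blast
qed

section \<open>Both counts as powers of \<open>N\<close>\<close>

lemma num_maximum_classes_lower:
  assumes "N > 2 * d + 1"
  shows "real N powr ((ln ((real N - real d) / (real d + 1)) / ln (real N)) *
           (1 / (real d + 1)) * real (N choose d)) \<le> real (num_maximum_classes N d)"
proof -
  obtain R where R: "(N choose d) \<le> Suc d * R"
    "(N div Suc d) ^ R \<le> card {F. maximum_family {1..N} (Suc d) F}"
    using card_maximum_families_ge by blast
  let ?q = "(real N - real d) / (real d + 1)"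
  \<comment> \<open>The base must be at least 1 for the power to grow with the exponent; this is
    where \<open>N\<close> has to exceed about \<open>2 * d\<close>.\<close>
  have q: "?q \<ge> 1" using assms by (simp add: field_simps)
  have "N = N div Suc d * Suc d + N mod Suc d" by (rule div_mult_mod_eq[symmetric])
  \<comment> \<open>The remainder is at most \<open>d\<close>, so \<open>?q\<close> is a lower bound
    for the integer quotient.\<close>
  moreover have "N mod Suc d \<le> d" using mod_less_divisor[of "Suc d" N] by simp
  ultimately have "N \<le> N div Suc d * Suc d + d" by linarith
  then have "real N \<le> real (N div Suc d * Suc d + d)" by (simp only: of_nat_le_iff)
  then have qN: "?q \<le> real (N div Suc d)" by (simp add: field_simps)
  have "real (N choose d) \<le> real (Suc d * R)" using R(1) by (simp only: of_nat_le_iff)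
  then have RR: "1 / (real d + 1) * real (N choose d) \<le> real R" by (simp add: field_simps)
  have "real N powr ((ln ?q / ln (real N)) * (1 / (real d + 1)) * real (N choose d)) =
      ?q powr (1 / (real d + 1) * real (N choose d))"
    using q assms by (simp add: powr_def)
  also have "\<dots> \<le> ?q powr real R"
    by (rule powr_mono[OF RR q])
  also have "\<dots> = ?q ^ R"
    using q by (subst powr_realpow) auto
  also have "\<dots> \<le> real (N div Suc d) ^ R"
    using qN q by (intro power_mono) auto
  also have "\<dots> \<le> real (card {F. maximum_family {1..N} (Suc d) F})"
    using R(2) by (metis of_nat_le_iff of_nat_power)
  also have "\<dots> = real (num_maximum_classes N d)"
    using assms by (subst num_maximum_classes_eq) auto
  finally show ?thesis .
qed

lemma num_maximum_classes_upper:
  assumes "d \<ge> 1" "N > d" "N \<ge> 2"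
  shows "real (num_maximum_classes N d)
           \<le> real N powr ((1 + ln 8 / ln (real N)) * (\<Sum>i=1..d. real (N choose i)))"
proof -
  define n where "n = (\<Sum>i=1..d. N choose i)"
  have "(\<Sum>i<Suc d. N choose i) = (\<Sum>i=0..d. N choose i)"
    by (simp add: atLeast0AtMost lessThan_Suc_atMost del: sum.lessThan_Suc)
  \<comment> \<open>The term \<open>i = 0\<close> is split off: a walk through \<open>n + 1\<close>
    vertices has only \<open>n\<close> labels, hence the sum from 1 in the exponent.\<close>
  also have "\<dots> = Suc n"
    unfolding n_def by (subst sum.atLeast_Suc_atMost) auto
  finally have n: "(\<Sum>i<Suc d. card {1..N} choose i) = Suc n" by simp
  \<comment> \<open>The term \<open>i = 1\<close> gives \<open>N \<le> n\<close>, so the factor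
    \<open>2 ^ N\<close> for the starting vertex is absorbed and the base becomes
    \<open>8 * N\<close>.\<close>
  have "N choose 1 \<le> n"
    unfolding n_def using assms by (intro member_le_sum) auto
  then have Nn: "N \<le> n" by simp
  have "num_maximum_classes N d \<le> 2 ^ N * (4 * N) ^ n"
    using card_maximum_families_le[OF finite_atLeastAtMost n] num_maximum_classes_eq[of d N] assms
    by simp
  also have "\<dots> \<le> 2 ^ n * (4 * N) ^ n"
    by (rule mult_le_mono1[OF power_increasing[OF Nn]]) simp
  also have "\<dots> = (8 * N) ^ n"
    by (subst power_mult_distrib[symmetric]) simp
  finally have "real (num_maximum_classes N d) \<le> (8 * real N) ^ n"
    by (simp flip: of_nat_le_iff[where 'a = real])
  also have "\<dots> = (8 * real N) powr real n"
    using assms by (subst powr_realpow) auto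
  also have "\<dots> = real N powr ((1 + ln 8 / ln (real N)) * real n)"
    using assms by (simp add: powr_def ln_mult field_simps)
  finally show ?thesis by (simp add: n_def)
qed

theorem theorem14:
  fixes d :: nat
  assumes "d > 1"
  shows "\<exists>(\<epsilon> :: nat \<Rightarrow> real) (\<delta> :: nat \<Rightarrow> real).
           \<epsilon> \<longlonglongrightarrow> 0 \<and> \<delta> \<longlonglongrightarrow> 0 \<and>
           (\<exists>N\<^sub>0 :: nat. \<forall>N > N\<^sub>0.
              real N powr ((1 + \<epsilon> N) * (1 / (real d + 1)) * real (N choose d))
                \<le> real (num_maximum_classes N d) \<and>
              real (num_maximum_classes N d)
                \<le> real N powr ((1 + \<delta> N) * (\<Sum>i=1..d. real (N choose i))))"
proof (intro exI conjI allI impI)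
  \<comment> \<open>The error terms come from writing the bases \<open>(N - d) / (d + 1)\<close> and
    \<open>8 * N\<close> as powers of \<open>N\<close>; both logarithms are asymptotic to
    \<open>ln N\<close>.\<close>
  let ?\<epsilon> = "\<lambda>N. ln ((real N - real d) / (real d + 1)) / ln (real N) - 1"
  let ?\<delta> = "\<lambda>N. ln 8 / ln (real N)"
  show "?\<epsilon> \<longlonglongrightarrow> 0" by real_asymp
  show "?\<delta> \<longlonglongrightarrow> 0" by real_asymp
  fix N assume N: "N > 2 * d + 1"
  show "real N powr ((1 + ?\<epsilon> N) * (1 / (real d + 1)) * real (N choose d))
      \<le> real (num_maximum_classes N d)"
    using num_maximum_classes_lower[OF N] by simp
  show "real (num_maximum_classes N d)
      \<le> real N powr ((1 + ?\<delta> N) * (\<Sum>i=1..d. real (N choose i)))"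
    using num_maximum_classes_upper[of d N] assms N by simp
qed

end
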